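(* Let $d\in\mathbb{N}$, let $\mathbf{X}=(X_1,\dots,X_d)$ be an integrable random vector with values in $\mathbb{N}_0^d$, and let $\mathbf{P}=(P_1,\dots,P_d)$ be a Poisson random vector with $\mathbb{E}[\mathbf{P}]=(\lambda_1,\dots,\lambda_d)\in[0,\infty)^d$. For each $1\le i\le d$, let $\mathbf{Z}^{(i)}=(Z^{(i)}_1,\dots,Z^{(i)}_i)$ be any random vector in $\mathbb{Z}^i$ defined on the same probability space as $\mathbf{X}$, and define $$q^{(i)}_{m_{1:i}}=m_i\,\mathbb{P}\big(X_{1:i}=m_{1:i}\big)-\lambda_i\,\mathbb{P}\big(X_{1:i}+\mathbf{Z}^{(i)}=(m_{1:i-1},m_i-1)\big)$$ for $m_{1:i}=(m_1,\dots,m_i)\in\mathbb{N}_0^i$ with $m_i\neq 0$. Then $$d_W(\mathbf{X},\mathbf{P})\le\sum_{i=1}^d\left(\lambda_i\,\mathbb{E}\big|Z^{(i)}_i\big|+2\lambda_i\sum_{j=1}^{i-1}\mathbb{E}\big|Z^{(i)}_j\big|+\sum_{\substack{m_{1:i}\in\mathbb{N}_0^i\\ m_i\neq 0}}\big|q^{(i)}_{m_{1:i}}\big|\right).$$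
   Context: $\mathbb{N}_0=\mathbb{N}\cup\{0\}$. For a vector $\mathbf{x}=(x_1,\dots,x_d)$ and $1\le j\le d$, $x_{1:j}$ denotes the subvector $(x_1,\dots,x_j)$ (empty subvectors are omitted, so for $i=1$ the vector $(m_{1:i-1},m_i-1)$ is just $m_1-1$). A Poisson random vector is a random vector with independent, Poisson distributed components (a Poisson variable with mean $0$ is almost surely $0$). For integrable random vectors $\mathbf{X},\mathbf{Y}$ in $\mathbb{N}_0^d$, the Wasserstein distance is $$d_W(\mathbf{X},\mathbf{Y})=\sup_{g\in\mathrm{Lip}^d(1)}\big|\mathbb{E}[g(\mathbf{X})]-\mathbb{E}[g(\mathbf{Y})]\big|,$$ where $\mathrm{Lip}^d(1)$ is the set of functions $g:\mathbb{N}_0^d\to\mathbb{R}$ with $|g(\mathbf{x})-g(\mathbf{y})|\le|\mathbf{x}-\mathbf{y}|_1=\sum_{i=1}^d|x_i-y_i|$ for all $\mathbf{x},\mathbf{y}\in\mathbb{N}_0^d$. *)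

theory Defs
  imports "HOL-Probability.Probability"
begin

text \<open>Vectors of length \<open>n\<close> are functions on the index set \<open>{1..n}\<close>, extended by
  \<open>undefined\<close> outside of it, so that equality of vectors is equality of functions.\<close>

definition vecs :: "nat \<Rightarrow> (nat \<Rightarrow> 'a) set" where
  "vecs n = {1..n} \<rightarrow>\<^sub>E UNIV"

definition subvec :: "nat \<Rightarrow> (nat \<Rightarrow> 'a) \<Rightarrow> nat \<Rightarrow> 'a" where
  "subvec i x = restrict x {1..i}"

text \<open>Used for the component types \<^typ>\<open>nat\<close> and \<^typ>\<open>int\<close> only, with the discrete
  sigma-algebra on each component.\<close>

definition random_vector :: "nat \<Rightarrow> 'w measure \<Rightarrow> ('w \<Rightarrow> nat \<Rightarrow> 'a) \<Rightarrow> bool" where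
  "random_vector n M X \<longleftrightarrow> X \<in> measurable M (Pi\<^sub>M {1..n} (\<lambda>_. count_space UNIV))"

definition integrable_vector :: "nat \<Rightarrow> 'w measure \<Rightarrow> ('w \<Rightarrow> nat \<Rightarrow> nat) \<Rightarrow> bool" where
  "integrable_vector n M X \<longleftrightarrow> (\<forall>i\<in>{1..n}. integrable M (\<lambda>\<omega>. real (X \<omega> i)))"

text \<open>The rate 0 is treated separately because the properties of \<^const>\<open>poisson_pmf\<close> are
  only established for positive rates.\<close>

definition poisson_law :: "real \<Rightarrow> nat pmf" where
  "poisson_law r = (if r = 0 then return_pmf 0 else poisson_pmf r)"

definition poisson_vector :: "nat \<Rightarrow> 'w measure \<Rightarrow> ('w \<Rightarrow> nat \<Rightarrow> nat) \<Rightarrow> bool" where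
  "poisson_vector n M Y \<longleftrightarrow>
     random_vector n M Y \<and>
     prob_space.indep_vars M (\<lambda>_. count_space UNIV) (\<lambda>i \<omega>. Y \<omega> i) {1..n} \<and>
     (\<forall>i\<in>{1..n}. \<exists>r\<ge>0. distr M (count_space UNIV) (\<lambda>\<omega>. Y \<omega> i) = measure_pmf (poisson_law r))"

text \<open>Values of \<open>g\<close> outside \<open>vecs n\<close> are unconstrained; a random vector takes its values
  in \<open>vecs n\<close>, so they play no role in the Wasserstein distance.\<close>

definition Lip1 :: "nat \<Rightarrow> ((nat \<Rightarrow> nat) \<Rightarrow> real) set" where
  "Lip1 n = {g. \<forall>x\<in>vecs n. \<forall>y\<in>vecs n. \<bar>g x - g y\<bar> \<le> (\<Sum>i=1..n. \<bar>real (x i) - real (y i)\<bar>)}"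

text \<open>Meaningful for integrable random vectors; \<open>X\<close> and \<open>Y\<close> may live on different
  probability spaces.\<close>

definition wasserstein_dist ::
  "nat \<Rightarrow> 'w measure \<Rightarrow> ('w \<Rightarrow> nat \<Rightarrow> nat) \<Rightarrow> 'v measure \<Rightarrow> ('v \<Rightarrow> nat \<Rightarrow> nat) \<Rightarrow> ennreal" where
  "wasserstein_dist n M X N Y =
     (SUP g\<in>Lip1 n. ennreal \<bar>(\<integral>\<omega>. g (X \<omega>) \<partial>M) - (\<integral>\<omega>. g (Y \<omega>) \<partial>N)\<bar>)"

definition q_coeff ::
  "'w measure \<Rightarrow> ('w \<Rightarrow> nat \<Rightarrow> nat) \<Rightarrow> ('w \<Rightarrow> nat \<Rightarrow> int) \<Rightarrow> real \<Rightarrow> nat \<Rightarrow> (nat \<Rightarrow> nat) \<Rightarrow> real" where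
  "q_coeff M X Z l i m =
     real (m i) * measure M {\<omega> \<in> space M. subvec i (X \<omega>) = m}
     - l * measure M {\<omega> \<in> space M.
         (\<lambda>j\<in>{1..i}. int (X \<omega> j) + Z \<omega> j) = (\<lambda>j\<in>{1..i}. int (m j))(i := int (m i) - 1)}"

end

theory Submission
  imports Defs
begin

text \<open>Replace the coordinates of \<open>X\<close> by independent Poisson variables one at a time, from the last
  to the first. Integrating out the Poisson coordinates already inserted turns a test function in
  \<open>Lip1 d\<close> into one in \<open>Lip1 i\<close>, so that the \<open>i\<close>-th replacement only involves the subvector of
  length \<open>i\<close> and its last coordinate. There the univariate Poisson Stein equation, applied with the first
  \<open>i - 1\<close> coordinates frozen, has a solution \<open>\<phi>\<close> with \<open>\<bar>\<phi>\<bar> \<le> 1\<close> and increments at most 1 in the last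
  coordinate. The definition of \<open>q\<close> converts \<open>E[X\<^sub>i \<phi>(X)]\<close> into \<open>\<lambda>\<^sub>i\<close> times the mean of \<open>\<phi>\<close> at the
  shifted vector plus \<open>\<Sum> q \<phi>\<close>. The shift costs at most \<open>\<bar>Z\<^sub>i\<bar>\<close> if only the last coordinate moves, and at most
  \<open>2 \<le> 2 \<Sum> \<bar>Z\<^sub>j\<bar>\<close> otherwise.\<close>

section \<open>Poisson Stein equation on the natural numbers\<close>

text \<open>The centered function is increasing, so it changes sign at most once. Either every
  summand is nonpositive, or the omitted tail is nonnegative while the full mean is 0.\<close>

lemma partial_sum_centered_nonpos:
  fixes p :: "nat pmf" and u :: "nat \<Rightarrow> real"
  assumes "mono u" "integrable (measure_pmf p) u"
  shows "(\<Sum>j\<le>k. pmf p j * (u j - measure_pmf.expectation p u)) \<le> 0"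
proof (cases "u k \<le> measure_pmf.expectation p u")
  case True
  then show ?thesis
    using assms(1) by (intro sum_nonpos mult_nonneg_nonpos) (auto dest: monoD intro: order_trans)
next
  case False
  let ?v = "\<lambda>j. u j - measure_pmf.expectation p u"
  have int: "integrable (measure_pmf p) ?v"
    using assms(2) by simp
  then have int': "integrable (measure_pmf p) (\<lambda>j. indicator {..k} j * ?v j)"
    using integrable_real_mult_indicator[of "{..k}" "measure_pmf p" ?v] by (simp add: mult.commute)
  have "(\<Sum>j\<le>k. pmf p j * ?v j) = measure_pmf.expectation p (\<lambda>j. indicator {..k} j * ?v j)"
    by (subst integral_measure_pmf[of "{..k}"]) (auto simp: indicator_def)
  also have "\<dots> \<le> measure_pmf.expectation p ?v"
  proof (rule integral_mono[OF int' int])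
    show "indicator {..k} j * ?v j \<le> ?v j" for j
      using False monoD[OF assms(1), of k j] by (cases "j \<le> k") auto
  qed
  also have "\<dots> = 0"
    using assms(2) by simp
  finally show ?thesis .
qed

section \<open>Weights and mean of the Poisson law\<close>

lemma pmf_poisson_Suc:
  assumes "0 < r"
  shows "real (Suc k) * pmf (poisson_pmf r) (Suc k) = r * pmf (poisson_pmf r) k"
proof -
  \<comment> \<open>This is \<open>fact (Suc k)\<close> expanded, the denominator to be
    cleared.\<close>
  have "fact k + real k * fact k \<noteq> (0 :: real)"
    by (simp add: add_nonneg_eq_0_iff)
  then show ?thesis
    using assms by (simp add: divide_simps)
qed

text \<open>The recursion for the weights turns the series of the mean into \<open>r\<close> times
  an exponential series; the nonnegative integral then gives integrability and value
  together.\<close>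

lemma poisson_expectation:
  assumes "0 < r"
  shows "integrable (measure_pmf (poisson_pmf r)) real" "measure_pmf.expectation (poisson_pmf r) real = r"
proof -
  let ?p = "poisson_pmf r"
  have *: "real (Suc n) * pmf ?p (Suc n) = r * (r ^ n /\<^sub>R fact n * exp (- r))" for n
    unfolding pmf_poisson_Suc[OF assms] using assms by (simp add: divide_inverse mult.assoc mult.left_commute)
  have "(\<lambda>n. r * (r ^ n /\<^sub>R fact n * exp (- r))) sums (r * (exp r * exp (- r)))"
    by (intro sums_mult sums_mult2 exp_converges)
  then have "(\<lambda>n. real (Suc n) * pmf ?p (Suc n)) sums r"
    unfolding * by (simp add: exp_minus)
  then have sm: "(\<lambda>n. real n * pmf ?p n) sums r"
    using sums_Suc[of "\<lambda>n. real n * pmf ?p n" r] by simp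
  have "(\<integral>\<^sup>+n. ennreal (real n) \<partial>?p) = (\<Sum>n. ennreal (real n * pmf ?p n))"
    by (simp add: nn_integral_measure_pmf nn_integral_count_space_nat ennreal_mult'' mult.commute del: pmf_poisson)
  also have "\<dots> = ennreal r"
    using sm by (intro suminf_ennreal_eq) auto
  finally have "has_bochner_integral ?p real r"
    using assms by (intro has_bochner_integral_nn_integral) auto
  then show "integrable ?p real" "measure_pmf.expectation ?p real = r"
    by (blast dest: has_bochner_integral_iff[THEN iffD1])+
qed

lemma poisson_law_expectation:
  assumes "0 \<le> r"
  shows "integrable (measure_pmf (poisson_law r)) real" "measure_pmf.expectation (poisson_law r) real = r"
  using assms poisson_expectation[of r] by (auto simp: poisson_law_def integrable_measure_pmf_finite)

lemma integrable_lipschitz_nat: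
  fixes h :: "nat \<Rightarrow> real" and p :: "nat pmf"
  assumes "\<And>j k. \<bar>h j - h k\<bar> \<le> \<bar>real j - real k\<bar>" "integrable (measure_pmf p) real"
  shows "integrable (measure_pmf p) h"
proof (rule Bochner_Integration.integrable_bound[of _ "\<lambda>k. \<bar>h 0\<bar> + real k"])
  have "\<bar>h k\<bar> \<le> \<bar>h 0\<bar> + real k" for k
    using assms(1)[of k 0] by linarith
  then show "AE x in measure_pmf p. norm (h x) \<le> norm (\<bar>h 0\<bar> + real x)"
    by simp
qed (use assms(2) in auto)

text \<open>Maximum principle: the strictly superharmonic comparison function \<open>k + a\<close> grows without
  bound, which forces the maximum of \<open>w k - \<epsilon> (k + a)\<close> to be attained.\<close>

lemma bounded_subharmonic_nonpos:
  fixes w :: "nat \<Rightarrow> real" and a B :: real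
  assumes a: "0 \<le> a"
    and bound: "\<And>k. 1 \<le> k \<Longrightarrow> w k \<le> B"
    and sub: "\<And>k. (real k + 2 + a) * w (Suc k) \<le> a * w (Suc (Suc k)) + real k * w k"
    and "1 \<le> k"
  shows "w k \<le> 0"
proof (rule ccontr)
  assume "\<not> w k \<le> 0"
  \<comment> \<open>With this slope \<open>v k\<close> equals \<open>w k / 2\<close>, hence is
    positive.\<close>
  define e where "e = w k / (2 * (real k + a))"
  define v where "v n = w n - e * (real n + a)" for n
  have "real k + a > 0"
    using a \<open>1 \<le> k\<close> by simp
  then have "e > 0" and vk: "v k > 0"
    using \<open>\<not> w k \<le> 0\<close> by (auto simp: e_def v_def divide_simps)
  have neg: "v n < v k" if "n \<ge> 1" "real n > B / e" for n
  proof -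
    have "w n \<le> B" using bound that by auto
    also have "B < e * real n" using that \<open>e > 0\<close> by (simp add: field_simps)
    also have "\<dots> \<le> e * (real n + a)" using \<open>e > 0\<close> a by (simp add: mult_left_mono)
    finally show ?thesis using vk by (simp add: v_def)
  qed
  obtain K where K: "real K > B / e" using reals_Archimedean2 by blast
  have small: "n < K" if "n \<ge> 1" "v k \<le> v n" for n
  proof (rule ccontr)
    assume "\<not> n < K"
    then have "real n > B / e" using K by simp
    then show False using neg[of n] that by simp
  qed
  \<comment> \<open>Wherever \<open>v\<close> is at least \<open>v k\<close> the index is below
    \<open>K\<close>, so the maximum over \<open>{1..K}\<close> is the maximum over all positive
    integers.\<close>
  obtain s where s: "1 \<le> s" "v k \<le> v s" and max: "\<And>n. 1 \<le> n \<Longrightarrow> v n \<le> v s"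
  proof -
    have "k \<in> {1..K}" using small[of k] \<open>1 \<le> k\<close> by auto
    then have "Max (v ` {1..K}) \<in> v ` {1..K}"
      by (intro Max_in) auto
    then obtain s where s_max: "s \<in> {1..K}" "Max (v ` {1..K}) = v s"
      by (elim imageE) simp
    have s: "s \<in> {1..K}" "\<forall>n\<in>{1..K}. v n \<le> v s"
      unfolding s_max(2)[symmetric] using s_max(1) by auto
    then have "v k \<le> v s" using \<open>k \<in> {1..K}\<close> by auto
    moreover have "v n \<le> v s" if "1 \<le> n" for n
    proof (cases "v k \<le> v n")
      case True
      then show ?thesis using small[of n] that s by auto
    qed (use \<open>v k \<le> v s\<close> in auto)
    ultimately show ?thesis using that s by auto
  qed
  obtain m where m: "s = Suc m" using s by (cases s) auto
  have "(real m + 2 + a) * v (Suc m) =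
      (real m + 2 + a) * w (Suc m) - e * ((real m + 2 + a) * (real m + 1 + a))"
    by (simp add: v_def algebra_simps)
  also have "\<dots> \<le> a * w (Suc (Suc m)) + real m * w m - e * ((real m + 2 + a) * (real m + 1 + a))"
    using sub[of m] by simp
  also have "\<dots> \<le> a * w (Suc (Suc m)) + real m * w m - e * (a * (real m + 2 + a) + real m * (real m + a))"
  proof -
    \<comment> \<open>The two sides differ by \<open>3 m + 2 + a\<close>: this is the strict
      superharmonicity.\<close>
    have "a * (real m + 2 + a) + real m * (real m + a) \<le> (real m + 2 + a) * (real m + 1 + a)"
      using a by (simp add: algebra_simps)
    then show ?thesis using \<open>e > 0\<close> by (simp add: mult_left_mono)
  qed
  also have "\<dots> = a * v (Suc (Suc m)) + real m * v m"
    by (simp add: v_def algebra_simps)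
  also have "\<dots> \<le> a * v (Suc m) + real m * v (Suc m)"
  proof (rule add_mono)
    show "a * v (Suc (Suc m)) \<le> a * v (Suc m)"
      using max[of "Suc (Suc m)"] a m by (simp add: mult_left_mono)
    \<comment> \<open>Index 0 is outside the range of \<open>max\<close>, but it carries weight
      0.\<close>
    show "real m * v m \<le> real m * v (Suc m)"
      using max[of m] m by (cases "m = 0") (simp_all add: mult_left_mono)
  qed
  \<comment> \<open>The coefficients leave \<open>2 * v (Suc m) \<le> 0\<close>.\<close>
  finally have "v (Suc m) \<le> 0" by (simp add: algebra_simps)
  then show False using s vk m by simp
qed

text \<open>Second differences of the equation give a three-term relation for the increments,
  perturbed by a second difference of \<open>h\<close>, which is at most 2. This equals the excess
  of the weight \<open>n + 2 + r\<close> over \<open>r\<close> plus \<open>n\<close>, so the maximum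
  principle applies to the absolute increment minus 1.\<close>

lemma stein_solution_increment_bound:
  fixes f h :: "nat \<Rightarrow> real"
  assumes "0 \<le> r"
    and lip: "\<And>k. \<bar>h (Suc k) - h k\<bar> \<le> 1"
    and eq: "\<And>k. r * f (Suc k) - real k * f k = h k - c"
    and bound: "\<And>k. 1 \<le> k \<Longrightarrow> \<bar>f k\<bar> \<le> 1"
    and "1 \<le> k"
  shows "\<bar>f (Suc k) - f k\<bar> \<le> 1"
proof -
  define D where "D n = f (Suc n) - f n" for n
  have "\<bar>D k\<bar> - 1 \<le> 0"
  proof (rule bounded_subharmonic_nonpos[where a = r and B = 1])
    \<comment> \<open>Two values bounded by 1 differ by at most 2, hence
      \<open>B = 1\<close>.\<close>
    show "\<bar>D n\<bar> - 1 \<le> 1" if "1 \<le> n" for n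
      using bound[of n] bound[of "Suc n"] that by (simp add: D_def)
    show "(real n + 2 + r) * (\<bar>D (Suc n)\<bar> - 1) \<le> r * (\<bar>D (Suc (Suc n))\<bar> - 1) + real n * (\<bar>D n\<bar> - 1)" for n
    proof -
      have "(real n + 2 + r) * D (Suc n) =
          r * D (Suc (Suc n)) + real n * D n - ((h (Suc (Suc n)) - h (Suc n)) - (h (Suc n) - h n))"
        using eq[of n] eq[of "Suc n"] eq[of "Suc (Suc n)"] by (simp add: D_def algebra_simps)
      then have "\<bar>(real n + 2 + r) * D (Suc n)\<bar> \<le> \<bar>r * D (Suc (Suc n))\<bar> + \<bar>real n * D n\<bar> + 2"
        using lip[of n] lip[of "Suc n"] by linarith
      then show ?thesis using \<open>0 \<le> r\<close> by (simp add: abs_mult algebra_simps)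
    qed
  qed (use assms in auto)
  then show ?thesis by (simp add: D_def)
qed

text \<open>Multiplied by the Poisson weights the equation telescopes, so normalized partial sums of
  the centered \<open>h\<close> solve it. For rate 0 it can be solved directly.\<close>

lemma stein_solution_exists:
  fixes h :: "nat \<Rightarrow> real"
  assumes r: "0 \<le> r" and lip: "\<And>j k. \<bar>h j - h k\<bar> \<le> \<bar>real j - real k\<bar>"
  obtains f :: "nat \<Rightarrow> real"
  where "\<And>k. r * f (Suc k) - real k * f k = h k - measure_pmf.expectation (poisson_law r) h"
    and "\<And>k. 1 \<le> k \<Longrightarrow> \<bar>f k\<bar> \<le> 1"
    and "\<And>k. 1 \<le> k \<Longrightarrow> \<bar>f (Suc k) - f k\<bar> \<le> 1"
proof -
  define c where "c = measure_pmf.expectation (poisson_law r) h"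
  have "\<exists>f. (\<forall>k. r * f (Suc k) - real k * f k = h k - c) \<and> (\<forall>k\<ge>1. \<bar>f k\<bar> \<le> 1)"
  proof (cases "r = 0")
    case True
    have "\<bar>(h 0 - h k) / real k\<bar> \<le> 1" for k
      using lip[of 0 k] by (cases "k = 0") (auto simp: field_simps)
    \<comment> \<open>At \<open>k = 0\<close> both sides of the equation vanish, because
      \<open>c = h 0\<close>.\<close>
    then show ?thesis
      using True by (intro exI[of _ "\<lambda>k. (h 0 - h k) / real k"]) (auto simp: c_def poisson_law_def)
  next
    case False
    then have "r > 0" using r by simp
    let ?p = "poisson_pmf r"
    have p_pos: "pmf ?p k > 0" for k using \<open>r > 0\<close> by simp
    have p_Suc: "real (Suc k) * pmf ?p (Suc k) = r * pmf ?p k" for k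
      using \<open>r > 0\<close> by (rule pmf_poisson_Suc)
    have c: "c = measure_pmf.expectation ?p h" using False by (simp add: c_def poisson_law_def)
    have int: "integrable (measure_pmf ?p) h"
      by (rule integrable_lipschitz_nat[OF lip poisson_expectation(1)[OF \<open>r > 0\<close>]])
    define S where "S k = (\<Sum>j\<le>k. pmf ?p j * (h j - c))" for k
    \<comment> \<open>The value at 0 is free: the equation multiplies it by 0 and the bounds start
      at 1.\<close>
    define f where "f k = (case k of 0 \<Rightarrow> 0 | Suc j \<Rightarrow> S j / (r * pmf ?p j))" for k
    have "r * f (Suc k) - real k * f k = h k - c" for k
    proof (cases k)
      case 0
      then show ?thesis using \<open>r > 0\<close> by (simp add: f_def S_def)
    next
      case (Suc j)
      have "real k * f k = S j / pmf ?p k"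
        unfolding f_def Suc p_Suc[symmetric] using p_pos[of "Suc j"] by (simp del: pmf_poisson)
      moreover have "r * f (Suc k) = S k / pmf ?p k"
        using \<open>r > 0\<close> by (simp add: f_def del: pmf_poisson)
      moreover have "S k = S j + pmf ?p k * (h k - c)"
        by (simp add: S_def Suc)
      ultimately have "r * f (Suc k) - real k * f k = (pmf ?p k * (h k - c)) / pmf ?p k"
        by (simp add: diff_divide_distrib[symmetric] del: pmf_poisson)
      then show ?thesis using p_pos[of k] by (simp del: pmf_poisson)
    qed
    moreover have "\<bar>f k\<bar> \<le> 1" if k: "1 \<le> k" for k
    proof -
      obtain j where j: "k = Suc j" using k by (cases k) auto
      \<comment> \<open>Both \<open>id + h\<close> and \<open>id - h\<close> are monotone, so the explicit partial sums of \<open>id\<close> control \<open>S\<close>.\<close>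
      have id: "(\<Sum>i\<le>n. pmf ?p i * (real i - r)) = - r * pmf ?p n" for n
      proof (induction n)
        case (Suc n)
        then show ?case using p_Suc[of n] by (simp add: algebra_simps del: pmf_poisson)
      qed (simp del: pmf_poisson)
      have "(\<Sum>i\<le>j. pmf ?p i * ((real i + s * h i) - measure_pmf.expectation ?p (\<lambda>i. real i + s * h i))) \<le> 0"
        if "\<bar>s\<bar> = 1" for s
      proof (rule partial_sum_centered_nonpos)
        have "\<bar>s * h x - s * h y\<bar> \<le> real y - real x" if "x \<le> y" for x y
          using lip[of x y] that \<open>\<bar>s\<bar> = 1\<close> by (simp add: abs_mult flip: right_diff_distrib)
        then show "mono (\<lambda>i. real i + s * h i)"
          by (intro monoI) (force simp: abs_le_iff algebra_simps)
      qed (use int poisson_expectation[OF \<open>r > 0\<close>] in auto)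
      moreover have "(\<Sum>i\<le>j. pmf ?p i * ((real i + s * h i) - measure_pmf.expectation ?p (\<lambda>i. real i + s * h i)))
          = - r * pmf ?p j + s * S j" for s
        using int poisson_expectation[OF \<open>r > 0\<close>]
        unfolding id[symmetric] S_def c
        by (simp add: sum_distrib_left sum.distrib[symmetric] algebra_simps del: pmf_poisson)
      ultimately have "- r * pmf ?p j + s * S j \<le> 0" if "\<bar>s\<bar> = 1" for s :: real
        using that by metis
      from this[of 1] this[of "-1"] have "\<bar>S j\<bar> \<le> r * pmf ?p j" by linarith
      then show ?thesis
        using \<open>r > 0\<close> p_pos[of j] by (simp add: f_def j abs_mult del: pmf_poisson)
    qed
    ultimately show ?thesis by blast
  qed
  then obtain f where f: "\<And>k. r * f (Suc k) - real k * f k = h k - c" "\<And>k. 1 \<le> k \<Longrightarrow> \<bar>f k\<bar> \<le> 1"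
    by auto
  moreover have "\<bar>f (Suc k) - f k\<bar> \<le> 1" if "1 \<le> k" for k
  proof (rule stein_solution_increment_bound[OF r _ f that])
    show "\<bar>h (Suc n) - h n\<bar> \<le> 1" for n
      using lip[of "Suc n" n] by simp
  qed
  ultimately show ?thesis using that unfolding c_def by blast
qed

section \<open>Random vectors on countable spaces\<close>

lemma countable_vecs: "countable (vecs n :: (nat \<Rightarrow> 'a::countable) set)"
  unfolding vecs_def by (intro countable_PiE) auto

text \<open>A finite product of countable discrete spaces is again discrete, so every function on
  \<open>vecs n\<close> becomes measurable.\<close>

lemma random_vector_iff_count_space:
  fixes Y :: "'w \<Rightarrow> nat \<Rightarrow> 'a::countable"
  shows "random_vector n M Y \<longleftrightarrow> Y \<in> measurable M (count_space (vecs n))"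
  unfolding random_vector_def vecs_def by (subst count_space_PiM_finite) auto

section \<open>Vectors of fixed length and Lipschitz functions on them\<close>

lemma vecs_fun_upd: "x \<in> vecs n \<Longrightarrow> j \<in> {1..n} \<Longrightarrow> x(j := a) \<in> vecs n"
  by (auto simp: vecs_def PiE_def extensional_def)

lemma subvec_vecs: "x \<in> vecs n \<Longrightarrow> subvec n x = x"
  unfolding vecs_def subvec_def by (rule PiE_restrict)

lemma subvec_in_vecs: "subvec n x \<in> vecs n"
  by (simp add: vecs_def subvec_def)

lemma Lip1D:
  "h \<in> Lip1 n \<Longrightarrow> x \<in> vecs n \<Longrightarrow> y \<in> vecs n \<Longrightarrow> \<bar>h x - h y\<bar> \<le> (\<Sum>i=1..n. \<bar>real (x i) - real (y i)\<bar>)"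
  by (simp add: Lip1_def)

lemma Lip1_fun_upd:
  assumes "h \<in> Lip1 n" "x \<in> vecs n" "i \<in> {1..n}"
  shows "\<bar>h (x(i := j)) - h (x(i := k))\<bar> \<le> \<bar>real j - real k\<bar>"
proof -
  have "\<bar>h (x(i := j)) - h (x(i := k))\<bar> \<le> (\<Sum>l=1..n. \<bar>real ((x(i := j)) l) - real ((x(i := k)) l)\<bar>)"
    using assms by (intro Lip1D vecs_fun_upd)
  also have "\<dots> = (\<Sum>l=1..n. if l = i then \<bar>real j - real k\<bar> else 0)"
    by (intro sum.cong) auto
  also have "\<dots> = \<bar>real j - real k\<bar>"
    using assms(3) by simp
  finally show ?thesis .
qed

text \<open>Compared with its value at the zero vector, a Lipschitz function grows no faster than
  the sum of the coordinates, which is integrable.\<close>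

lemma integrable_Lip1:
  assumes "prob_space M" "Y \<in> measurable M (count_space (vecs n))" "integrable_vector n M Y" "h \<in> Lip1 n"
  shows "integrable M (\<lambda>\<omega>. h (Y \<omega>))"
proof (rule Bochner_Integration.integrable_bound)
  interpret prob_space M by fact
  let ?o = "\<lambda>j\<in>{1..n}. 0 :: nat"
  show "integrable M (\<lambda>\<omega>. \<bar>h ?o\<bar> + (\<Sum>j=1..n. real (Y \<omega> j)))"
    using assms(3) unfolding integrable_vector_def
    by (intro Bochner_Integration.integrable_add Bochner_Integration.integrable_sum) simp_all
  show "(\<lambda>\<omega>. h (Y \<omega>)) \<in> borel_measurable M"
    using assms(2) by (rule measurable_compose) simp
  show "AE \<omega> in M. norm (h (Y \<omega>)) \<le> norm (\<bar>h ?o\<bar> + (\<Sum>j=1..n. real (Y \<omega> j)))"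
  proof (intro AE_I2)
    fix \<omega> assume "\<omega> \<in> space M"
    then have "Y \<omega> \<in> vecs n" using assms(2) by (auto dest: measurable_space)
    then have "\<bar>h (Y \<omega>) - h ?o\<bar> \<le> (\<Sum>j=1..n. \<bar>real (Y \<omega> j) - real (?o j)\<bar>)"
      by (intro Lip1D[OF assms(4)]) (auto simp: vecs_def)
    also have "\<dots> = (\<Sum>j=1..n. real (Y \<omega> j))"
      by (intro sum.cong) auto
    finally show "norm (h (Y \<omega>)) \<le> norm (\<bar>h ?o\<bar> + (\<Sum>j=1..n. real (Y \<omega> j)))"
      by (simp add: sum_nonneg)
  qed
qed

text \<open>The law of \<open>Y\<close> has density \<open>w\<close> with respect to counting
  measure, so integrability becomes absolute summability. This is the bridge from expectations to
  sums of \<open>q_coeff\<close>.\<close>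

lemma has_sum_expectation_discrete:
  fixes u :: "'a \<Rightarrow> real"
  assumes "prob_space M" "countable C" and Y: "Y \<in> measurable M (count_space C)"
    and int: "integrable M (\<lambda>\<omega>. u (Y \<omega>))"
  shows "((\<lambda>c. u c * measure M {\<omega> \<in> space M. Y \<omega> = c}) has_sum (\<integral>\<omega>. u (Y \<omega>) \<partial>M)) C"
proof -
  interpret prob_space M by fact
  define w where "w c = measure M {\<omega> \<in> space M. Y \<omega> = c}" for c
  have D: "distr M (count_space C) Y = density (count_space C) (\<lambda>c. ennreal (w c))"
  proof (rule measure_eqI_countable[where A = C])
    fix c assume "c \<in> C"
    then have "emeasure (distr M (count_space C) Y) {c} = emeasure M {\<omega> \<in> space M. Y \<omega> = c}"
      by (subst emeasure_distr[OF Y]) (auto intro!: arg_cong[where f = "emeasure M"])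
    also have "\<dots> = emeasure (density (count_space C) (\<lambda>c. ennreal (w c))) {c}"
      using \<open>c \<in> C\<close> by (subst emeasure_density) (auto simp: w_def emeasure_eq_measure nn_integral_count_space_indicator)
    finally show "emeasure (distr M (count_space C) Y) {c} = emeasure (density (count_space C) (\<lambda>c. ennreal (w c))) {c}" .
  qed (use \<open>countable C\<close> in auto)
  have "integrable (distr M (count_space C) Y) u"
    using int by (subst integrable_distr_eq[OF Y]) auto
  then have "integrable (count_space C) (\<lambda>c. w c * u c)"
    unfolding D by (subst (asm) integrable_density) (auto simp: w_def)
  then have summable: "Infinite_Set_Sum.abs_summable_on (\<lambda>c. u c * w c) C"
    by (simp add: Infinite_Set_Sum.abs_summable_on_def mult.commute)
  have "(\<integral>\<omega>. u (Y \<omega>) \<partial>M) = (\<integral>c. u c \<partial>distr M (count_space C) Y)"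
    by (subst integral_distr[OF Y]) auto
  also have "\<dots> = infsetsum (\<lambda>c. u c * w c) C"
    unfolding D by (subst integral_density) (auto simp: w_def infsetsum_def mult.commute)
  also have "\<dots> = infsum (\<lambda>c. u c * w c) C"
    using summable by (rule infsetsum_infsum)
  finally show ?thesis
    using has_sum_infsum[OF abs_summable_summable[OF abs_summable_equivalent[THEN iffD2, OF summable]]]
    unfolding w_def by simp
qed

text \<open>Finite partial sums obey the bound, and it passes to the limit along finite subsets. The
  majorant lives in \<open>ennreal\<close> and may be infinite.\<close>

lemma has_sum_abs_le_infsum:
  fixes u v :: "'a \<Rightarrow> real"
  assumes "(u has_sum s) A" "\<And>x. x \<in> A \<Longrightarrow> \<bar>u x\<bar> \<le> \<bar>v x\<bar>"
  shows "ennreal \<bar>s\<bar> \<le> (\<Sum>\<^sub>\<infinity>x\<in>A. ennreal \<bar>v x\<bar>)"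
proof (rule tendsto_upperbound)
  show "((\<lambda>F. ennreal \<bar>sum u F\<bar>) \<longlongrightarrow> ennreal \<bar>s\<bar>) (finite_subsets_at_top A)"
    using assms(1) unfolding has_sum_def by (intro tendsto_intros)
  show "\<forall>\<^sub>F F in finite_subsets_at_top A. ennreal \<bar>sum u F\<bar> \<le> (\<Sum>\<^sub>\<infinity>x\<in>A. ennreal \<bar>v x\<bar>)"
  proof (rule eventually_finite_subsets_at_top_weakI)
    fix F assume F: "finite F" "F \<subseteq> A"
    have "\<bar>sum u F\<bar> \<le> (\<Sum>x\<in>F. \<bar>v x\<bar>)"
      using assms(2) F by (intro order_trans[OF sum_abs] sum_mono) auto
    then have "ennreal \<bar>sum u F\<bar> \<le> (\<Sum>x\<in>F. ennreal \<bar>v x\<bar>)"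
      by (simp add: sum_ennreal ennreal_leI)
    also have "\<dots> \<le> (\<Sum>\<^sub>\<infinity>x\<in>A. ennreal \<bar>v x\<bar>)"
      unfolding infsum_finite[OF F(1), symmetric] using F(2)
      by (intro infsum_mono_neutral nonneg_summable_on_complete) auto
    finally show "ennreal \<bar>sum u F\<bar> \<le> (\<Sum>\<^sub>\<infinity>x\<in>A. ennreal \<bar>v x\<bar>)" .
  qed
qed simp

section \<open>The Stein equation in one coordinate\<close>

text \<open>The vector at which the Stein solution is evaluated after the shift by \<open>z\<close>; the zero vector
  stands for a shift that leaves the nonnegative orthant.\<close>

definition shifted :: "nat \<Rightarrow> (nat \<Rightarrow> nat) \<Rightarrow> (nat \<Rightarrow> int) \<Rightarrow> nat \<Rightarrow> nat" where
  "shifted n x z =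
     (if \<forall>j\<in>{1..n}. 0 \<le> int (x j) + z j
      then (\<lambda>j\<in>{1..n}. nat (int (x j) + z j))(n := Suc (nat (int (x n) + z n)))
      else (\<lambda>j\<in>{1..n}. 0))"

lemma shifted_in_vecs: "1 \<le> n \<Longrightarrow> shifted n x z \<in> vecs n"
  by (auto simp: shifted_def vecs_def PiE_def extensional_def)

lemma shifted_apply:
  assumes "\<forall>j\<in>{1..n}. 0 \<le> int (x j) + z j"
  shows "shifted n x z j =
    (if j = n then Suc (nat (int (x n) + z n)) else if j \<in> {1..n} then nat (int (x j) + z j) else undefined)"
  unfolding shifted_def if_P[OF assms] by simp

text \<open>Turns the second event in \<open>q_coeff\<close> into a level set of
  \<open>shifted\<close>: the \<open>Suc\<close> in the last coordinate undoes the
  \<open>- 1\<close>.\<close>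

lemma shifted_eq_iff:
  assumes "1 \<le> n" "m \<in> vecs n" "m n \<noteq> 0"
  shows "shifted n x z = m \<longleftrightarrow>
    (\<lambda>j\<in>{1..n}. int (x j) + z j) = (\<lambda>j\<in>{1..n}. int (m j))(n := int (m n) - 1)"
proof -
  have "(\<lambda>j\<in>{1..n}. int (x j) + z j) = (\<lambda>j\<in>{1..n}. int (m j))(n := int (m n) - 1) \<longleftrightarrow>
      (\<forall>j\<in>{1..n}. int (x j) + z j = (if j = n then int (m n) - 1 else int (m j)))"
  proof
    assume *: "(\<lambda>j\<in>{1..n}. int (x j) + z j) = (\<lambda>j\<in>{1..n}. int (m j))(n := int (m n) - 1)"
    show "\<forall>j\<in>{1..n}. int (x j) + z j = (if j = n then int (m n) - 1 else int (m j))"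
    proof
      fix j assume "j \<in> {1..n}"
      then show "int (x j) + z j = (if j = n then int (m n) - 1 else int (m j))"
        using fun_cong[OF *, of j] by (cases "j = n") simp_all
    qed
  next
    assume *: "\<forall>j\<in>{1..n}. int (x j) + z j = (if j = n then int (m n) - 1 else int (m j))"
    show "(\<lambda>j\<in>{1..n}. int (x j) + z j) = (\<lambda>j\<in>{1..n}. int (m j))(n := int (m n) - 1)"
    proof
      fix j
      show "(\<lambda>j\<in>{1..n}. int (x j) + z j) j = ((\<lambda>j\<in>{1..n}. int (m j))(n := int (m n) - 1)) j"
        using bspec[OF *, of j] assms(1) by (auto simp: restrict_def)
    qed
  qed
  also have "\<dots> \<longleftrightarrow> shifted n x z = m"
  proof
    assume *: "\<forall>j\<in>{1..n}. int (x j) + z j = (if j = n then int (m n) - 1 else int (m j))"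
    have "\<forall>j\<in>{1..n}. 0 \<le> int (x j) + z j"
    proof
      fix j assume "j \<in> {1..n}"
      with * have "int (x j) + z j = (if j = n then int (m n) - 1 else int (m j))" by (rule bspec)
      then show "0 \<le> int (x j) + z j" using assms(3) by (cases "j = n") simp_all
    qed
    moreover have "int (x n) + z n = int (m n) - 1"
      using bspec[OF *, of n] assms(1) by simp
    moreover have "nat (int (x j) + z j) = m j" if "j \<in> {1..n}" "j \<noteq> n" for j
      using bspec[OF *, of j] that by simp
    moreover have "m j = undefined" if "j \<notin> {1..n}" for j
      using assms(2) that unfolding vecs_def by (rule PiE_arb)
    ultimately show "shifted n x z = m"
      using assms(3) by (intro ext) (simp only: shifted_apply, auto)
  next
    assume *: "shifted n x z = m"
    \<comment> \<open>The default zero vector has last coordinate 0, which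
      \<open>m n \<noteq> 0\<close> rules out.\<close>
    have nonneg: "\<forall>j\<in>{1..n}. 0 \<le> int (x j) + z j"
    proof (rule ccontr)
      assume "\<not> ?thesis"
      then have "shifted n x z n = 0" using assms(1) by (auto simp: shifted_def)
      then show False using * assms(3) by simp
    qed
    from shifted_apply[OF this] have m: "m j =
        (if j = n then Suc (nat (int (x n) + z n)) else if j \<in> {1..n} then nat (int (x j) + z j) else undefined)" for j
      unfolding * .
    show "\<forall>j\<in>{1..n}. int (x j) + z j = (if j = n then int (m n) - 1 else int (m j))"
      using nonneg by (auto simp: m)
  qed
  finally show ?thesis by simp
qed

text \<open>Integrality drives the estimate: a nonzero shift of a coordinate has size at least 1. A
  move among the first \<open>n - 1\<close> coordinates thus pays for the trivial bound 2; otherwise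
  only the last coordinate has to be followed.\<close>

lemma shifted_difference_bound:
  fixes \<phi> :: "(nat \<Rightarrow> nat) \<Rightarrow> real"
  assumes n: "1 \<le> n" and y: "y \<in> vecs n"
    and zero: "\<And>m. m n = 0 \<Longrightarrow> \<phi> m = 0"
    and bound: "\<And>m. m \<in> vecs n \<Longrightarrow> \<bar>\<phi> m\<bar> \<le> 1"
    and incr: "\<And>k. 1 \<le> k \<Longrightarrow> \<bar>\<phi> (y(n := Suc k)) - \<phi> (y(n := k))\<bar> \<le> 1"
  shows "\<bar>\<phi> (y(n := Suc (y n))) - \<phi> (shifted n y z)\<bar>
    \<le> \<bar>real_of_int (z n)\<bar> + 2 * (\<Sum>j=1..n-1. \<bar>real_of_int (z j)\<bar>)"
proof -
  have "\<bar>\<phi> (y(n := Suc (y n)))\<bar> \<le> 1" "\<bar>\<phi> (shifted n y z)\<bar> \<le> 1"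
    using n y by (auto intro!: bound vecs_fun_upd shifted_in_vecs)
  then have two: "\<bar>\<phi> (y(n := Suc (y n))) - \<phi> (shifted n y z)\<bar> \<le> 2"
    by linarith
  have sum_nonneg: "0 \<le> (\<Sum>j=1..n-1. \<bar>real_of_int (z j)\<bar>)"
    by (simp add: sum_nonneg)
  show ?thesis
  proof (cases "\<exists>j\<in>{1..n-1}. z j \<noteq> 0")
    case True
    then obtain j where j: "j \<in> {1..n-1}" "z j \<noteq> 0" by blast
    have "1 \<le> \<bar>real_of_int (z j)\<bar>"
      using j(2) by linarith
    also have "\<dots> \<le> (\<Sum>j=1..n-1. \<bar>real_of_int (z j)\<bar>)"
      using j(1) by (intro member_le_sum) auto
    finally show ?thesis using two by simp
  next
    case False
    then have z0: "z j = 0" if "j \<in> {1..n}" "j \<noteq> n" for j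
      using that by force
    have "\<bar>\<phi> (y(n := Suc (y n))) - \<phi> (shifted n y z)\<bar> \<le> \<bar>real_of_int (z n)\<bar>"
    proof (cases "0 \<le> int (y n) + z n")
      case True
      then have nonneg: "\<forall>j\<in>{1..n}. 0 \<le> int (y j) + z j"
        using z0 by (intro ballI) (case_tac "j = n"; simp)
      have "y j = undefined" if "j \<notin> {1..n}" for j
        using y that unfolding vecs_def by (rule PiE_arb)
      then have shifted: "shifted n y z = y(n := Suc (nat (int (y n) + z n)))"
        using z0 by (intro ext) (simp only: shifted_apply[OF nonneg], auto)
      \<comment> \<open>Increments are used for unit steps only; a larger shift is covered by the
        bound 2.\<close>
      consider "z n = 0" | "z n = 1" | "z n = -1" | "2 \<le> \<bar>z n\<bar>"
        by linarith
      then show ?thesis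
      proof cases
        case 2
        then show ?thesis
          using incr[of "Suc (y n)"] unfolding shifted by (simp add: nat_add_distrib abs_minus_commute)
      next
        case 3
        \<comment> \<open>Staying in the orthant forces \<open>1 \<le> y n\<close>, as
          \<open>incr\<close> requires at \<open>k = y n\<close>.\<close>
        then have "Suc (nat (int (y n) + z n)) = y n" "1 \<le> y n"
          using True by auto
        then show ?thesis
          using incr[of "y n"] 3 unfolding shifted by simp
      next
        case 4
        then show ?thesis using two by linarith
      qed (simp add: shifted)
    next
      case False
      \<comment> \<open>Leaving the orthant lands on the default vector, where \<phi> vanishes; the
        other term is at most 1.\<close>
      then have "shifted n y z n = 0" "z n \<noteq> 0"
        using n by (auto simp: shifted_def)
      moreover have "1 \<le> \<bar>real_of_int (z n)\<bar>"
        using \<open>z n \<noteq> 0\<close> by linarith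
      ultimately show ?thesis
        using zero[of "shifted n y z"] \<open>\<bar>\<phi> (y(n := Suc (y n)))\<bar> \<le> 1\<close> by simp
    qed
    then show ?thesis using sum_nonneg by linarith
  qed
qed

text \<open>The univariate equation is solved separately on each line parallel to the last
  coordinate axis.\<close>

lemma stein_solution_Lip1_exists:
  assumes n: "1 \<le> n" and r: "0 \<le> r" and h: "h \<in> Lip1 n"
  obtains \<phi> :: "(nat \<Rightarrow> nat) \<Rightarrow> real"
  where "\<And>y. y \<in> vecs n \<Longrightarrow>
      r * \<phi> (y(n := Suc (y n))) - real (y n) * \<phi> y =
      h y - measure_pmf.expectation (poisson_law r) (\<lambda>k. h (y(n := k)))"
    and "\<And>m. m n = 0 \<Longrightarrow> \<phi> m = 0"
    and "\<And>m. m \<in> vecs n \<Longrightarrow> \<bar>\<phi> m\<bar> \<le> 1"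
    and "\<And>y k. y \<in> vecs n \<Longrightarrow> 1 \<le> k \<Longrightarrow> \<bar>\<phi> (y(n := Suc k)) - \<phi> (y(n := k))\<bar> \<le> 1"
proof -
  have "\<exists>f. (\<forall>k. r * f (Suc k) - real k * f k =
        h (x(n := k)) - measure_pmf.expectation (poisson_law r) (\<lambda>k. h (x(n := k)))) \<and>
      (\<forall>k\<ge>1. \<bar>f k\<bar> \<le> 1) \<and> (\<forall>k\<ge>1. \<bar>f (Suc k) - f k\<bar> \<le> 1)" if x: "x \<in> vecs n" for x
  proof -
    have "\<bar>h (x(n := j)) - h (x(n := k))\<bar> \<le> \<bar>real j - real k\<bar>" for j k
      using h x n by (intro Lip1_fun_upd) auto
    from stein_solution_exists[OF r this] show ?thesis by metis
  qed
  then obtain F where F: "\<And>x k. x \<in> vecs n \<Longrightarrow> r * F x (Suc k) - real k * F x k =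
        h (x(n := k)) - measure_pmf.expectation (poisson_law r) (\<lambda>k. h (x(n := k)))"
      "\<And>x k. x \<in> vecs n \<Longrightarrow> 1 \<le> k \<Longrightarrow> \<bar>F x k\<bar> \<le> 1"
      "\<And>x k. x \<in> vecs n \<Longrightarrow> 1 \<le> k \<Longrightarrow> \<bar>F x (Suc k) - F x k\<bar> \<le> 1"
    by metis
  \<comment> \<open>Resetting the last coordinate to 0 labels the line through \<open>m\<close>, so
    vectors on one line share one solution. The value 0 at \<open>m n = 0\<close> is compatible with
    the equation, which gives it weight 0.\<close>
  define \<phi> where "\<phi> m = (if m n = 0 then 0 else F (m(n := 0)) (m n))" for m
  have base: "y(n := 0) \<in> vecs n" if "y \<in> vecs n" for y :: "nat \<Rightarrow> nat"
    using that n by (intro vecs_fun_upd) auto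
  show ?thesis
  proof (rule that[of \<phi>])
    fix y :: "nat \<Rightarrow> nat" assume y: "y \<in> vecs n"
    show "r * \<phi> (y(n := Suc (y n))) - real (y n) * \<phi> y =
        h y - measure_pmf.expectation (poisson_law r) (\<lambda>k. h (y(n := k)))"
      using F(1)[OF base[OF y], of "y n"] by (auto simp: \<phi>_def)
    show "\<bar>\<phi> y\<bar> \<le> 1"
      using F(2)[OF base[OF y], of "y n"] by (auto simp: \<phi>_def)
    show "\<bar>\<phi> (y(n := Suc k)) - \<phi> (y(n := k))\<bar> \<le> 1" if "1 \<le> k" for k
      using F(3)[OF base[OF y] that] that by (auto simp: \<phi>_def)
  qed (simp add: \<phi>_def)
qed

text \<open>Integrate the Stein equation, then add and subtract \<open>r\<close> times the mean of
  \<phi> at the shifted vector. In the resulting split, \<open>?D\<close> is the cost of replacing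
  the unit increment by the shift and \<open>?Q\<close> pairs \<phi> with
  \<open>q_coeff\<close>.\<close>

lemma poisson_coordinate_bound:
  fixes M :: "'w measure" and Y :: "'w \<Rightarrow> nat \<Rightarrow> nat" and Z :: "'w \<Rightarrow> nat \<Rightarrow> int"
  assumes M: "prob_space M" and n: "1 \<le> n" and r: "0 \<le> r"
    and Y: "random_vector n M Y" "integrable_vector n M Y"
    and Z: "random_vector n M Z" and h: "h \<in> Lip1 n"
  shows "ennreal \<bar>(\<integral>\<omega>. h (Y \<omega>) \<partial>M) -
        (\<integral>\<omega>. measure_pmf.expectation (poisson_law r) (\<lambda>k. h ((Y \<omega>)(n := k))) \<partial>M)\<bar>
    \<le> ennreal r * (\<integral>\<^sup>+\<omega>. ennreal \<bar>real_of_int (Z \<omega> n)\<bar> \<partial>M)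
      + 2 * ennreal r * (\<Sum>j=1..n-1. \<integral>\<^sup>+\<omega>. ennreal \<bar>real_of_int (Z \<omega> j)\<bar> \<partial>M)
      + (\<Sum>\<^sub>\<infinity>m\<in>{m \<in> vecs n. m n \<noteq> 0}. ennreal \<bar>q_coeff M Y Z r n m\<bar>)"
proof -
  interpret prob_space M by fact
  obtain \<phi> where stein: "\<And>y. y \<in> vecs n \<Longrightarrow>
      r * \<phi> (y(n := Suc (y n))) - real (y n) * \<phi> y =
      h y - measure_pmf.expectation (poisson_law r) (\<lambda>k. h (y(n := k)))"
    and zero: "\<And>m. m n = 0 \<Longrightarrow> \<phi> m = 0"
    and bound: "\<And>m. m \<in> vecs n \<Longrightarrow> \<bar>\<phi> m\<bar> \<le> 1"
    and incr: "\<And>y k. y \<in> vecs n \<Longrightarrow> 1 \<le> k \<Longrightarrow> \<bar>\<phi> (y(n := Suc k)) - \<phi> (y(n := k))\<bar> \<le> 1"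
    using stein_solution_Lip1_exists[OF n r h] by blast
  define V where "V \<omega> = shifted n (Y \<omega>) (Z \<omega>)" for \<omega>
  define U where "U \<omega> = (Y \<omega>)(n := Suc (Y \<omega> n))" for \<omega>
  have Ym: "Y \<in> measurable M (count_space (vecs n))" and Zm: "Z \<in> measurable M (count_space (vecs n))"
    using Y(1) Z by (simp_all add: random_vector_iff_count_space)
  have Yv: "Y \<omega> \<in> vecs n" if "\<omega> \<in> space M" for \<omega>
    using Ym that by (auto dest: measurable_space)
  have Um: "U \<in> measurable M (count_space (vecs n))"
    unfolding U_def using Ym
  proof (rule measurable_compose)
    show "(\<lambda>y. y(n := Suc (y n))) \<in> measurable (count_space (vecs n)) (count_space (vecs n))"
      using n by (simp add: vecs_fun_upd del: fun_upd_apply)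
  qed
  have Vm: "V \<in> measurable M (count_space (vecs n))"
    unfolding V_def
  \<comment> \<open>\<open>V\<close> depends on both vectors; as \<open>Y\<close> takes countably
    many values, its value may be fixed.\<close>
  proof (rule measurable_compose_countable'[OF _ Ym countable_vecs])
    show "(\<lambda>\<omega>. shifted n y (Z \<omega>)) \<in> measurable M (count_space (vecs n))" for y
      using Zm by (rule measurable_compose) (use n in \<open>auto intro!: shifted_in_vecs\<close>)
  qed
  have int_\<phi>: "integrable M (\<lambda>\<omega>. \<phi> (W \<omega>))" if "W \<in> measurable M (count_space (vecs n))" for W
  proof (rule integrable_const_bound[where B = 1])
    show "(\<lambda>\<omega>. \<phi> (W \<omega>)) \<in> borel_measurable M"
      using that by (rule measurable_compose) simp
    show "AE \<omega> in M. norm (\<phi> (W \<omega>)) \<le> 1"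
      using that by (intro AE_I2) (auto intro!: bound dest: measurable_space)
  qed
  have int_Y: "integrable M (\<lambda>\<omega>. real (Y \<omega> n) * \<phi> (Y \<omega>))"
  proof (rule Bochner_Integration.integrable_bound)
    show "integrable M (\<lambda>\<omega>. real (Y \<omega> n))"
      using Y(2) n by (auto simp: integrable_vector_def)
    show "(\<lambda>\<omega>. real (Y \<omega> n) * \<phi> (Y \<omega>)) \<in> borel_measurable M"
      using Ym by (rule measurable_compose) simp
    show "AE \<omega> in M. norm (real (Y \<omega> n) * \<phi> (Y \<omega>)) \<le> norm (real (Y \<omega> n))"
      using bound[OF Yv] by (intro AE_I2) (auto simp: abs_mult intro!: mult_left_le)
  qed
  let ?D = "(\<integral>\<omega>. \<phi> (U \<omega>) - \<phi> (V \<omega>) \<partial>M)"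
  let ?Q = "(\<integral>\<omega>. real (Y \<omega> n) * \<phi> (Y \<omega>) \<partial>M) - r * (\<integral>\<omega>. \<phi> (V \<omega>) \<partial>M)"
  have int_h: "integrable M (\<lambda>\<omega>. h (Y \<omega>))"
    using M Ym Y(2) h by (rule integrable_Lip1)
  \<comment> \<open>The Stein equation read backwards expresses the inner expectation through terms
    already known to be integrable.\<close>
  have "(\<integral>\<omega>. measure_pmf.expectation (poisson_law r) (\<lambda>k. h ((Y \<omega>)(n := k))) \<partial>M) =
      (\<integral>\<omega>. h (Y \<omega>) - (r * \<phi> (U \<omega>) - real (Y \<omega> n) * \<phi> (Y \<omega>)) \<partial>M)"
    using stein[OF Yv] by (intro Bochner_Integration.integral_cong) (auto simp: U_def)
  then have split: "(\<integral>\<omega>. h (Y \<omega>) \<partial>M) -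
      (\<integral>\<omega>. measure_pmf.expectation (poisson_law r) (\<lambda>k. h ((Y \<omega>)(n := k))) \<partial>M) = r * ?D - ?Q"
    using int_h int_Y int_\<phi>[OF Um] int_\<phi>[OF Vm] by (simp add: algebra_simps)

  have "((\<lambda>m. real (m n) * \<phi> m * prob {\<omega> \<in> space M. Y \<omega> = m}
        + (- r) * (\<phi> m * prob {\<omega> \<in> space M. V \<omega> = m}))
      has_sum ((\<integral>\<omega>. real (Y \<omega> n) * \<phi> (Y \<omega>) \<partial>M) + (- r) * (\<integral>\<omega>. \<phi> (V \<omega>) \<partial>M))) (vecs n)"
    using has_sum_expectation_discrete[OF M countable_vecs Ym, of "\<lambda>m. real (m n) * \<phi> m"] int_Y
      has_sum_expectation_discrete[OF M countable_vecs Vm, of \<phi>] int_\<phi>[OF Vm]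
    by (intro has_sum_add has_sum_cmult_right)
  then have "((\<lambda>m. real (m n) * \<phi> m * prob {\<omega> \<in> space M. Y \<omega> = m} - r * (\<phi> m * prob {\<omega> \<in> space M. V \<omega> = m}))
      has_sum ?Q) (vecs n)"
    by simp
  \<comment> \<open>Terms with \<open>m n = 0\<close> drop out because \<phi> vanishes there, which
    leaves the index set of the coefficients.\<close>
  then have Q_sum: "((\<lambda>m. \<phi> m * q_coeff M Y Z r n m) has_sum ?Q) {m \<in> vecs n. m n \<noteq> 0}"
  proof (rule has_sum_cong_neutral[THEN iffD1, rotated -1])
    fix m :: "nat \<Rightarrow> nat" assume "m \<in> vecs n \<inter> {m \<in> vecs n. m n \<noteq> 0}"
    then have m: "m \<in> vecs n" "m n \<noteq> 0" by auto
    have "{\<omega> \<in> space M. subvec n (Y \<omega>) = m} = {\<omega> \<in> space M. Y \<omega> = m}"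
      using Yv by (auto simp: subvec_vecs)
    then show "real (m n) * \<phi> m * prob {\<omega> \<in> space M. Y \<omega> = m} - r * (\<phi> m * prob {\<omega> \<in> space M. V \<omega> = m})
        = \<phi> m * q_coeff M Y Z r n m"
      by (simp add: q_coeff_def V_def shifted_eq_iff[OF n m] algebra_simps)
  qed (auto simp: zero)
  have Q_bound: "ennreal \<bar>?Q\<bar> \<le> (\<Sum>\<^sub>\<infinity>m\<in>{m \<in> vecs n. m n \<noteq> 0}. ennreal \<bar>q_coeff M Y Z r n m\<bar>)"
    using Q_sum by (rule has_sum_abs_le_infsum) (auto simp: abs_mult intro!: mult_left_le_one_le bound)

  \<comment> \<open>The shift cost is bounded by nonnegative integrals, which allow infinite moments
    of \<open>Z\<close>.\<close>
  have Z_meas: "(\<lambda>\<omega>. ennreal \<bar>real_of_int (Z \<omega> j)\<bar>) \<in> borel_measurable M" for j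
    using Zm by (rule measurable_compose) simp
  have "ennreal \<bar>r * ?D\<bar> = ennreal r * ennreal (norm ?D)"
    using r by (simp add: abs_mult ennreal_mult)
  also have "\<dots> \<le> ennreal r * (\<integral>\<^sup>+\<omega>. ennreal (norm (\<phi> (U \<omega>) - \<phi> (V \<omega>))) \<partial>M)"
    using int_\<phi>[OF Um] int_\<phi>[OF Vm] by (intro mult_left_mono integral_norm_bound_ennreal) auto
  also have "\<dots> \<le> ennreal r * (\<integral>\<^sup>+\<omega>. ennreal \<bar>real_of_int (Z \<omega> n)\<bar> +
      2 * (\<Sum>j=1..n-1. ennreal \<bar>real_of_int (Z \<omega> j)\<bar>) \<partial>M)"
  proof (intro mult_left_mono nn_integral_mono)
    fix \<omega> assume "\<omega> \<in> space M"
    have "norm (\<phi> (U \<omega>) - \<phi> (V \<omega>)) \<le> \<bar>real_of_int (Z \<omega> n)\<bar> + 2 * (\<Sum>j=1..n-1. \<bar>real_of_int (Z \<omega> j)\<bar>)"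
      unfolding U_def V_def real_norm_def
      by (rule shifted_difference_bound[OF n Yv[OF \<open>\<omega> \<in> space M\<close>] zero bound incr[OF Yv[OF \<open>\<omega> \<in> space M\<close>]]])
    then have "ennreal (norm (\<phi> (U \<omega>) - \<phi> (V \<omega>))) \<le>
        ennreal (\<bar>real_of_int (Z \<omega> n)\<bar> + 2 * (\<Sum>j=1..n-1. \<bar>real_of_int (Z \<omega> j)\<bar>))"
      by (rule ennreal_leI)
    also have "\<dots> = ennreal \<bar>real_of_int (Z \<omega> n)\<bar> + 2 * (\<Sum>j=1..n-1. ennreal \<bar>real_of_int (Z \<omega> j)\<bar>)"
      by (simp add: ennreal_plus ennreal_mult sum_ennreal sum_nonneg del: ennreal_plus[symmetric])
    finally show "ennreal (norm (\<phi> (U \<omega>) - \<phi> (V \<omega>))) \<le>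
        ennreal \<bar>real_of_int (Z \<omega> n)\<bar> + 2 * (\<Sum>j=1..n-1. ennreal \<bar>real_of_int (Z \<omega> j)\<bar>)" .
  qed simp
  also have "\<dots> = ennreal r * (\<integral>\<^sup>+\<omega>. ennreal \<bar>real_of_int (Z \<omega> n)\<bar> \<partial>M)
      + 2 * ennreal r * (\<Sum>j=1..n-1. \<integral>\<^sup>+\<omega>. ennreal \<bar>real_of_int (Z \<omega> j)\<bar> \<partial>M)"
    using Z_meas by (simp add: nn_integral_add nn_integral_cmult nn_integral_sum distrib_left mult_ac del: sum_ennreal)
  finally have D_bound: "ennreal \<bar>r * ?D\<bar> \<le> \<dots>" .
  have "ennreal \<bar>r * ?D - ?Q\<bar> \<le> ennreal (\<bar>r * ?D\<bar> + \<bar>?Q\<bar>)"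
    by (intro ennreal_leI) linarith
  also have "\<dots> = ennreal \<bar>r * ?D\<bar> + ennreal \<bar>?Q\<bar>"
    by (rule ennreal_plus) auto
  also note add_mono[OF D_bound Q_bound]
  finally show ?thesis unfolding split .
qed

section \<open>Interpolation between the two vectors\<close>

definition hybrid_vector :: "nat \<Rightarrow> nat \<Rightarrow> (nat \<Rightarrow> nat) \<Rightarrow> (nat \<Rightarrow> nat) \<Rightarrow> nat \<Rightarrow> nat" where
  "hybrid_vector d i x y = (\<lambda>j\<in>{1..d}. if j \<le> i then x j else y j)"

text \<open>The conditional mean of \<open>g\<close> given the first \<open>i\<close> coordinates
  when the later ones are independent with laws \<open>L j\<close>.\<close>

definition hybrid_mean ::
  "nat \<Rightarrow> (nat \<Rightarrow> nat pmf) \<Rightarrow> ((nat \<Rightarrow> nat) \<Rightarrow> real) \<Rightarrow> nat \<Rightarrow> (nat \<Rightarrow> nat) \<Rightarrow> real" where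
  "hybrid_mean d L g i x = (\<integral>y. g (hybrid_vector d i x y) \<partial>PiM {Suc i..d} (\<lambda>j. measure_pmf (L j)))"

lemma hybrid_vector_in_vecs: "hybrid_vector d i x y \<in> vecs d"
  by (simp add: hybrid_vector_def vecs_def)

lemma hybrid_mean_subvec:
  "i \<le> d \<Longrightarrow> hybrid_mean d L g i (subvec i x) = hybrid_mean d L g i x"
  unfolding hybrid_mean_def
  by (intro Bochner_Integration.integral_cong arg_cong[where f = g]) (auto simp: hybrid_vector_def subvec_def)

section \<open>Discrete product laws and averaging over the tail\<close>

lemma prob_space_PiM_pmf: "prob_space (PiM I (\<lambda>j. measure_pmf (L j)))"
  by (intro prob_space_PiM measure_pmf.prob_space_axioms)

lemma sets_PiM_pmf:
  fixes L :: "nat \<Rightarrow> nat pmf"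
  assumes "finite I"
  shows "sets (PiM I (\<lambda>j. measure_pmf (L j))) = sets (count_space (I \<rightarrow>\<^sub>E UNIV))"
proof -
  have "sets (PiM I (\<lambda>j. measure_pmf (L j))) = sets (PiM I (\<lambda>j. count_space (UNIV :: nat set)))"
    by (intro sets_PiM_cong) auto
  then show ?thesis
    using assms by (simp add: count_space_PiM_finite)
qed

lemma measurable_PiM_pmf:
  fixes L :: "nat \<Rightarrow> nat pmf"
  assumes "finite I" "f \<in> (I \<rightarrow>\<^sub>E UNIV) \<rightarrow> space N"
  shows "f \<in> measurable (PiM I (\<lambda>j. measure_pmf (L j))) N"
  using assms by (simp add: measurable_cong_sets[OF sets_PiM_pmf refl])

text \<open>Each coordinate of the hybrid is either constant or has law \<open>L j\<close>, so the
  integrability criterion for Lipschitz functions applies.\<close>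

lemma integrable_hybrid:
  assumes g: "g \<in> Lip1 d" and L: "\<And>j. j \<in> {1..d} \<Longrightarrow> integrable (measure_pmf (L j)) real"
  shows "integrable (PiM {Suc i..d} (\<lambda>j. measure_pmf (L j))) (\<lambda>y. g (hybrid_vector d i x y))"
proof (rule integrable_Lip1[OF prob_space_PiM_pmf _ _ g])
  let ?P = "PiM {Suc i..d} (\<lambda>j. measure_pmf (L j))"
  interpret prob_space ?P by (rule prob_space_PiM_pmf)
  show "hybrid_vector d i x \<in> measurable ?P (count_space (vecs d))"
    by (intro measurable_PiM_pmf) (auto simp: hybrid_vector_in_vecs)
  show "integrable_vector d ?P (hybrid_vector d i x)"
    unfolding integrable_vector_def
  proof
    fix j assume j: "j \<in> {1..d}"
    show "integrable ?P (\<lambda>y. real (hybrid_vector d i x y j))"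
    proof (cases "j \<le> i")
      case False
      then have "j \<in> {Suc i..d}" using j by simp
      then have "distr ?P (measure_pmf (L j)) (\<lambda>y. y j) = measure_pmf (L j)"
        by (intro distr_PiM_component measure_pmf.prob_space_axioms)
      then have "integrable (distr ?P (measure_pmf (L j)) (\<lambda>y. y j)) real"
        using L[OF j] by simp
      then have "integrable ?P (\<lambda>y. real (y j))"
        using \<open>j \<in> {Suc i..d}\<close> by (subst (asm) integrable_distr_eq) auto
      then show ?thesis using False j by (simp add: hybrid_vector_def)
    qed (use j in \<open>simp add: hybrid_vector_def\<close>)
  qed
qed

text \<open>For a fixed tail the two hybrids differ only in the first \<open>i\<close> coordinates,
  and averaging keeps the pointwise bound.\<close>

lemma hybrid_mean_Lip1:
  assumes g: "g \<in> Lip1 d" and L: "\<And>j. j \<in> {1..d} \<Longrightarrow> integrable (measure_pmf (L j)) real" and "i \<le> d"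
  shows "hybrid_mean d L g i \<in> Lip1 i"
  unfolding Lip1_def
proof (intro CollectI ballI)
  fix x x' :: "nat \<Rightarrow> nat"
  let ?P = "PiM {Suc i..d} (\<lambda>j. measure_pmf (L j))"
  let ?b = "\<Sum>j=1..i. \<bar>real (x j) - real (x' j)\<bar>"
  interpret prob_space ?P by (rule prob_space_PiM_pmf)
  have ptw: "\<bar>g (hybrid_vector d i x y) - g (hybrid_vector d i x' y)\<bar> \<le> ?b" for y
  proof -
    have "\<bar>g (hybrid_vector d i x y) - g (hybrid_vector d i x' y)\<bar>
        \<le> (\<Sum>j=1..d. \<bar>real (hybrid_vector d i x y j) - real (hybrid_vector d i x' y j)\<bar>)"
      by (intro Lip1D[OF g] hybrid_vector_in_vecs)
    also have "\<dots> = ?b"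
      using \<open>i \<le> d\<close> by (intro sum.mono_neutral_cong_right) (auto simp: hybrid_vector_def)
    finally show ?thesis .
  qed
  have int: "integrable ?P (\<lambda>y. g (hybrid_vector d i x y))" for x
    using g L by (rule integrable_hybrid)
  have "\<bar>hybrid_mean d L g i x - hybrid_mean d L g i x'\<bar> =
      \<bar>\<integral>y. g (hybrid_vector d i x y) - g (hybrid_vector d i x' y) \<partial>?P\<bar>"
    using int by (simp add: hybrid_mean_def)
  also have "\<dots> \<le> (\<integral>y. \<bar>g (hybrid_vector d i x y) - g (hybrid_vector d i x' y)\<bar> \<partial>?P)"
    by (rule integral_abs_bound)
  also have "\<dots> \<le> ?b"
    using int ptw by (intro integral_le_const) auto
  finally show "\<bar>hybrid_mean d L g i x - hybrid_mean d L g i x'\<bar> \<le> ?b" .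
qed

text \<open>No coordinate is left to average over, and a probability measure integrates a constant
  to itself.\<close>

lemma hybrid_mean_top:
  assumes "x \<in> vecs d"
  shows "hybrid_mean d L g d x = g x"
proof -
  interpret prob_space "PiM {Suc d..d} (\<lambda>j. measure_pmf (L j))" by (rule prob_space_PiM_pmf)
  have "hybrid_vector d d x y = subvec d x" for y
    by (auto simp: hybrid_vector_def subvec_def)
  then show ?thesis
    unfolding hybrid_mean_def by (simp only: subvec_vecs[OF assms] lebesgue_integral_const prob_space scaleR_one)
qed

lemma hybrid_mean_0: "hybrid_mean d L g 0 x = (\<integral>y. g y \<partial>PiM {1..d} (\<lambda>j. measure_pmf (L j)))"
proof -
  have "hybrid_vector d 0 x y = y" if "y \<in> {1..d} \<rightarrow>\<^sub>E UNIV" for y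
  proof -
    have "hybrid_vector d 0 x y = restrict y {1..d}"
      unfolding hybrid_vector_def by (rule restrict_ext) simp
    then show ?thesis using PiE_restrict[OF that] by simp
  qed
  then show ?thesis
    unfolding hybrid_mean_def One_nat_def
    by (intro Bochner_Integration.integral_cong refl arg_cong[where f = g]) (simp add: space_PiM)
qed

text \<open>Fubini for the splitting of the tail into coordinate \<open>i\<close> and the
  coordinates after it: the latter are integrated first.\<close>

lemma hybrid_mean_step:
  assumes g: "g \<in> Lip1 d" and L: "\<And>j. j \<in> {1..d} \<Longrightarrow> integrable (measure_pmf (L j)) real" and i: "i \<in> {1..d}"
  shows "hybrid_mean d L g (i - 1) x = measure_pmf.expectation (L i) (\<lambda>k. hybrid_mean d L g i (x(i := k)))"
proof -
  let ?M = "\<lambda>j. measure_pmf (L j)"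
  interpret product_sigma_finite ?M
    by standard
  have I: "{i} \<union> {Suc i..d} = {Suc (i - 1)..d}"
    using i by auto
  have merge: "hybrid_vector d (i - 1) x (merge {i} {Suc i..d} (z, y)) = hybrid_vector d i (x(i := z i)) y" for z y
    using i by (auto simp: hybrid_vector_def merge_def fun_eq_iff)
  have "hybrid_mean d L g (i - 1) x =
      (\<integral>z. (\<integral>y. g (hybrid_vector d (i - 1) x (merge {i} {Suc i..d} (z, y))) \<partial>PiM {Suc i..d} ?M) \<partial>PiM {i} ?M)"
    unfolding hybrid_mean_def I[symmetric]
    using integrable_hybrid[OF g L, where i = "i - 1" and x = x] unfolding I[symmetric]
    by (intro product_integral_fold) auto
  also have "\<dots> = (\<integral>z. hybrid_mean d L g i (x(i := z i)) \<partial>PiM {i} ?M)"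
    unfolding merge hybrid_mean_def ..
  also have "\<dots> = measure_pmf.expectation (L i) (\<lambda>k. hybrid_mean d L g i (x(i := k)))"
    by (rule product_integral_singleton) simp
  finally show ?thesis .
qed

section \<open>Law of the Poisson vector and the telescoping argument\<close>

lemma distr_poisson_vector:
  assumes N: "prob_space N" and "1 \<le> d" and P: "poisson_vector d N P"
    and mean: "\<And>i. i \<in> {1..d} \<Longrightarrow> (\<integral>\<omega>. real (P \<omega> i) \<partial>N) = lam i"
  shows "distr N (PiM {1..d} (\<lambda>_. count_space UNIV)) P = PiM {1..d} (\<lambda>i. measure_pmf (poisson_law (lam i)))"
proof -
  interpret prob_space N by fact
  have Pm: "P \<in> measurable N (PiM {1..d} (\<lambda>_. count_space UNIV))"
    using P by (simp add: poisson_vector_def random_vector_def)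
  have rv: "(\<lambda>\<omega>. P \<omega> i) \<in> measurable N (count_space UNIV)" if "i \<in> {1..d}" for i
    using measurable_component_singleton[OF that] by (rule measurable_compose[OF Pm])
  have law: "distr N (count_space UNIV) (\<lambda>\<omega>. P \<omega> i) = measure_pmf (poisson_law (lam i))" if i: "i \<in> {1..d}" for i
  proof -
    obtain r where r: "0 \<le> r" "distr N (count_space UNIV) (\<lambda>\<omega>. P \<omega> i) = measure_pmf (poisson_law r)"
      using P i unfolding poisson_vector_def by blast
    \<comment> \<open>\<open>poisson_vector\<close> only provides some rate \<open>r\<close>;
      comparing means identifies it with \<open>lam i\<close>.\<close>
    have "lam i = (\<integral>k. real k \<partial>distr N (count_space UNIV) (\<lambda>\<omega>. P \<omega> i))"
      using mean[OF i] rv[OF i] by (subst integral_distr) auto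
    also have "\<dots> = r"
      unfolding r(2) using r(1) by (rule poisson_law_expectation)
    finally show ?thesis using r(2) by simp
  qed
  \<comment> \<open>The product form of independence speaks of restricted tuples; the values of
    \<open>P\<close> are already restricted.\<close>
  have "distr N (PiM {1..d} (\<lambda>_. count_space UNIV)) P =
      distr N (PiM {1..d} (\<lambda>_. count_space UNIV)) (\<lambda>\<omega>. \<lambda>i\<in>{1..d}. P \<omega> i)"
  proof (intro distr_cong refl)
    fix \<omega> assume "\<omega> \<in> space N"
    then have "P \<omega> \<in> {1..d} \<rightarrow>\<^sub>E UNIV"
      using measurable_space[OF Pm] by (simp add: space_PiM)
    then show "P \<omega> = (\<lambda>i\<in>{1..d}. P \<omega> i)"
      by (rule PiE_restrict[symmetric])
  qed
  also have "\<dots> = PiM {1..d} (\<lambda>i. distr N (count_space UNIV) (\<lambda>\<omega>. P \<omega> i))"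
    using P \<open>1 \<le> d\<close> rv
    by (subst indep_vars_iff_distr_eq_PiM'[symmetric]) (auto simp: poisson_vector_def)
  also have "\<dots> = PiM {1..d} (\<lambda>i. measure_pmf (poisson_law (lam i)))"
    using law by (intro PiM_cong) auto
  finally show ?thesis .
qed

text \<open>Only coordinates up to \<open>i\<close> enter, so the one-coordinate bound for the
  truncated vector carries the coefficients of \<open>X\<close>.\<close>

lemma q_coeff_subvec: "q_coeff M (\<lambda>\<omega>. subvec i (X \<omega>)) Z l i m = q_coeff M X Z l i m"
proof -
  have "subvec i (subvec i x) = subvec i x" for x :: "nat \<Rightarrow> nat"
    by (simp add: subvec_def)
  moreover have "(\<lambda>j\<in>{1..i}. int (subvec i x j) + z j) = (\<lambda>j\<in>{1..i}. int (x j) + z j)" for x z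
    by (rule restrict_ext) (simp add: subvec_def)
  ultimately show ?thesis
    by (simp only: q_coeff_def)
qed

theorem theorem1p1:
  fixes d :: nat
    and M :: "'w measure" and N :: "'v measure"
    and X :: "'w \<Rightarrow> nat \<Rightarrow> nat" and P :: "'v \<Rightarrow> nat \<Rightarrow> nat"
    and lam :: "nat \<Rightarrow> real"
    and Z :: "nat \<Rightarrow> 'w \<Rightarrow> nat \<Rightarrow> int"
  assumes "d \<ge> 1"
    and "prob_space M" and "prob_space N"
    and "random_vector d M X" and "integrable_vector d M X"
    and "\<And>i. i \<in> {1..d} \<Longrightarrow> lam i \<ge> 0"
    and "poisson_vector d N P"
    and "\<And>i. i \<in> {1..d} \<Longrightarrow> (\<integral>\<omega>. real (P \<omega> i) \<partial>N) = lam i"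
    and "\<And>i. i \<in> {1..d} \<Longrightarrow> random_vector i M (Z i)"
  shows "wasserstein_dist d M X N P \<le>
    (\<Sum>i=1..d.
        ennreal (lam i) * (\<integral>\<^sup>+\<omega>. ennreal \<bar>real_of_int (Z i \<omega> i)\<bar> \<partial>M)
      + 2 * ennreal (lam i) * (\<Sum>j=1..i-1. \<integral>\<^sup>+\<omega>. ennreal \<bar>real_of_int (Z i \<omega> j)\<bar> \<partial>M)
      + (\<Sum>\<^sub>\<infinity>m\<in>{m \<in> vecs i. m i \<noteq> 0}. ennreal \<bar>q_coeff M X (Z i) (lam i) i m\<bar>))"
  (is "_ \<le> (\<Sum>i=1..d. ?B i)")
  unfolding wasserstein_dist_def
proof (rule SUP_least)
  fix g :: "(nat \<Rightarrow> nat) \<Rightarrow> real" assume g: "g \<in> Lip1 d"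
  interpret M: prob_space M by fact
  let ?L = "\<lambda>i. poisson_law (lam i)"
  let ?H = "hybrid_mean d ?L g"
  \<comment> \<open>Interpolates between the two expectations: \<open>a d\<close> belongs to
    \<open>X\<close> and \<open>a 0\<close> to \<open>P\<close>.\<close>
  define a where "a i = (\<integral>\<omega>. ?H i (X \<omega>) \<partial>M)" for i
  have L: "integrable (measure_pmf (?L j)) real" if "j \<in> {1..d}" for j
    using assms(6)[OF that] by (rule poisson_law_expectation)
  have Xm: "X \<in> measurable M (count_space (vecs d))"
    using assms(4) by (simp add: random_vector_iff_count_space)
  have a_top: "a d = (\<integral>\<omega>. g (X \<omega>) \<partial>M)"
    unfolding a_def using measurable_space[OF Xm]
    by (intro Bochner_Integration.integral_cong refl) (simp add: hybrid_mean_top)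
  have a_0: "a 0 = (\<integral>\<omega>. g (P \<omega>) \<partial>N)"
  proof -
    have "P \<in> measurable N (PiM {1..d} (\<lambda>_. count_space UNIV))"
      using assms(7) by (simp add: poisson_vector_def random_vector_def)
    then have "(\<integral>y. g y \<partial>distr N (PiM {1..d} (\<lambda>_. count_space UNIV)) P) = (\<integral>\<omega>. g (P \<omega>) \<partial>N)"
      by (rule integral_distr) (simp add: count_space_PiM_finite)
    moreover have "distr N (PiM {1..d} (\<lambda>_. count_space UNIV)) P = PiM {1..d} (\<lambda>j. measure_pmf (?L j))"
      using assms(3,1,7,8) by (rule distr_poisson_vector)
    ultimately show ?thesis
      by (simp only: a_def hybrid_mean_0 lebesgue_integral_const M.prob_space scaleR_one)
  qed
  have telescope: "a n - a 0 = (\<Sum>i=1..n. a i - a (i - 1))" for n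
    by (induction n) simp_all
  have step: "ennreal \<bar>a i - a (i - 1)\<bar> \<le> ?B i" if i: "i \<in> {1..d}" for i
  proof -
    \<comment> \<open>Truncation changes none of the hybrid means involved and places the
      replacement in dimension \<open>i\<close>.\<close>
    define Y where "Y \<omega> = subvec i (X \<omega>)" for \<omega>
    have "Y \<in> measurable M (count_space (vecs i))"
      unfolding Y_def using Xm by (rule measurable_compose) (simp add: subvec_in_vecs)
    then have Y: "random_vector i M Y" "integrable_vector i M Y"
      using assms(5) i by (auto simp: random_vector_iff_count_space integrable_vector_def Y_def subvec_def)
    have "?H i (Y \<omega>) = ?H i (X \<omega>)" for \<omega>
      using i by (simp add: Y_def hybrid_mean_subvec)
    moreover have "?H (i - 1) (X \<omega>) = measure_pmf.expectation (?L i) (\<lambda>k. ?H i ((Y \<omega>)(i := k)))" for \<omega>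
    proof -
      \<comment> \<open>Agreement of the shorter truncations moves the hybrid mean from
        \<open>X\<close> to \<open>Y\<close>, where coordinate \<open>i\<close> is integrated
        out.\<close>
      have "subvec (i - 1) (Y \<omega>) = subvec (i - 1) (X \<omega>)"
        by (auto simp: subvec_def Y_def)
      then have "?H (i - 1) (X \<omega>) = ?H (i - 1) (Y \<omega>)"
        using i hybrid_mean_subvec[of "i - 1" d ?L g] by (metis atLeastAtMost_iff diff_le_self le_trans)
      then show ?thesis
        using hybrid_mean_step[OF g L i] by simp
    qed
    ultimately have "a i - a (i - 1) = (\<integral>\<omega>. ?H i (Y \<omega>) \<partial>M) -
        (\<integral>\<omega>. measure_pmf.expectation (?L i) (\<lambda>k. ?H i ((Y \<omega>)(i := k))) \<partial>M)"
      by (simp add: a_def)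
    moreover have "q_coeff M Y (Z i) (lam i) i m = q_coeff M X (Z i) (lam i) i m" for m
      unfolding Y_def by (rule q_coeff_subvec)
    moreover have "?H i \<in> Lip1 i"
      by (rule hybrid_mean_Lip1[OF g]) (use L i in simp_all)
    moreover have "1 \<le> i" using i by simp
    ultimately show ?thesis
      using poisson_coordinate_bound[OF assms(2) _ assms(6)[OF i] Y assms(9)[OF i], of "?H i"] by (simp only:)
  qed
  have "ennreal \<bar>(\<integral>\<omega>. g (X \<omega>) \<partial>M) - (\<integral>\<omega>. g (P \<omega>) \<partial>N)\<bar> = ennreal \<bar>\<Sum>i=1..d. a i - a (i - 1)\<bar>"
    unfolding telescope[symmetric] a_top a_0 ..
  also have "\<dots> \<le> ennreal (\<Sum>i=1..d. \<bar>a i - a (i - 1)\<bar>)"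
    by (intro ennreal_leI sum_abs)
  also have "\<dots> = (\<Sum>i=1..d. ennreal \<bar>a i - a (i - 1)\<bar>)"
    by (simp add: sum_ennreal)
  also have "\<dots> \<le> (\<Sum>i=1..d. ?B i)"
    by (intro sum_mono step)
  finally show "ennreal \<bar>(\<integral>\<omega>. g (X \<omega>) \<partial>M) - (\<integral>\<omega>. g (P \<omega>) \<partial>N)\<bar> \<le> (\<Sum>i=1..d. ?B i)" .
qed

end
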